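(* Let $m\ge1$. There are no self-dual $\mathsf{ad}$-nilpotent ideals for $\mathfrak{sl}_{2m}$. For $\mathfrak{sl}_{2m+1}$, the number of self-dual $\mathsf{ad}$-nilpotent ideals (of the standard Borel subalgebra) is equal to $\dfrac1{m+1}\dbinom{2m}{m}$.
   Context: Positive roots of $\mathfrak{sl}_n$ ($n\ge2$) are identified with pairs $(i,j)$, $1\le i<j\le n$, where $\alpha_i=(i,i+1)$ are the simple roots and $(i,j)=\alpha_i+\dots+\alpha_{j-1}$. An $\mathsf{ad}$-nilpotent ideal is a set $I$ of positive roots such that $(i,j)\in I$, $i'\le i$, $j'\ge j$ imply $(i',j')\in I$; its generators are its minimal elements in the root order (antichains of positive roots correspond bijectively to ideals). Duality $I\mapsto I^*$: if the generators of $I$ are $(i_1,j_1),\dots,(i_k,j_k)$, then $I^*$ is the ideal with generators $(i_q^*,j_q^* )$, $1\le q\le n-1-k$, where $i_1^*<i_2^*<\cdots$ are the elements of $\{1,\dots,n-1\}\setminus\{j_1-1,\dots,j_k-1\}$ and $j_1^*<j_2^*<\cdots$ are the elements of $\{2,\dots,n\}\setminus\{i_1+1,\dots,i_k+1\}$. This is a well-defined involution on the set of $\mathsf{ad}$-nilpotent ideals of $\mathfrak{sl}_n$. An ideal $I$ is self-dual if $I^*=I$. *)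

theory Defs
  imports Complex_Main
begin

text \<open>The pair \<open>(i, j)\<close> with \<open>1 \<le> i < j \<le> n\<close> stands for the positive root
  \<open>\<alpha>\<^sub>i + \<dots> + \<alpha>\<^sub>j\<^sub>-\<^sub>1\<close> of \<open>sl\<^sub>n\<close>.\<close>

definition pos_roots :: "nat \<Rightarrow> (nat \<times> nat) set" where
  "pos_roots n = {(i, j). 1 \<le> i \<and> i < j \<and> j \<le> n}"

text \<open>The root order: \<open>\<beta> - \<alpha>\<close> is a sum of positive roots or zero iff the interval of simple roots
  of \<open>\<alpha>\<close> is contained in that of \<open>\<beta>\<close>.\<close>

definition root_le :: "nat \<times> nat \<Rightarrow> nat \<times> nat \<Rightarrow> bool" where
  "root_le \<alpha> \<beta> \<longleftrightarrow> fst \<beta> \<le> fst \<alpha> \<and> snd \<alpha> \<le> snd \<beta>"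

definition ad_nilpotent_ideal :: "nat \<Rightarrow> (nat \<times> nat) set \<Rightarrow> bool" where
  "ad_nilpotent_ideal n I \<longleftrightarrow>
     I \<subseteq> pos_roots n \<and> (\<forall>\<alpha>\<in>I. \<forall>\<beta>\<in>pos_roots n. root_le \<alpha> \<beta> \<longrightarrow> \<beta> \<in> I)"

definition generators :: "(nat \<times> nat) set \<Rightarrow> (nat \<times> nat) set" where
  "generators I = {\<alpha> \<in> I. \<forall>\<beta>\<in>I. root_le \<beta> \<alpha> \<longrightarrow> \<beta> = \<alpha>}"

definition ideal_generated_by :: "nat \<Rightarrow> (nat \<times> nat) set \<Rightarrow> (nat \<times> nat) set" where
  "ideal_generated_by n G = {\<beta> \<in> pos_roots n. \<exists>\<alpha>\<in>G. root_le \<alpha> \<beta>}"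

text \<open>The pairs \<open>(i\<^sub>q\<^sup>*, j\<^sub>q\<^sup>*)\<close>: the two complements are listed increasingly and paired off. For an
  ideal \<open>I\<close> both lists have length \<open>n - 1 - k\<close> where \<open>k\<close> is the number of generators of \<open>I\<close>
  (\<open>length_dual_lists\<close> below), so that \<open>zip\<close> drops nothing.\<close>

definition dual_generators :: "nat \<Rightarrow> (nat \<times> nat) set \<Rightarrow> (nat \<times> nat) set" where
  "dual_generators n I =
     set (zip (sorted_list_of_set ({1..n - 1} - {j - 1 |i j. (i, j) \<in> generators I}))
              (sorted_list_of_set ({2..n} - {i + 1 |i j. (i, j) \<in> generators I})))"

text \<open>For an ideal \<open>I\<close>, the pairs \<open>(i\<^sub>q\<^sup>*, j\<^sub>q\<^sup>*)\<close> are exactly the generators of the ideal they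
  generate, see \<open>generators_dual_ideal\<close> below.\<close>

definition dual_ideal :: "nat \<Rightarrow> (nat \<times> nat) set \<Rightarrow> (nat \<times> nat) set" where
  "dual_ideal n I = ideal_generated_by n (dual_generators n I)"

definition self_dual :: "nat \<Rightarrow> (nat \<times> nat) set \<Rightarrow> bool" where
  "self_dual n I \<longleftrightarrow> dual_ideal n I = I"


lemma ad_nilpotent_ideal_dual_ideal: "ad_nilpotent_ideal n (dual_ideal n I)"
  unfolding ad_nilpotent_ideal_def dual_ideal_def ideal_generated_by_def root_le_def
  by (auto intro: order_trans)

lemma finite_pos_roots: "finite (pos_roots n)"
  by (rule finite_subset[of _ "{..n} \<times> {..n}"]) (auto simp: pos_roots_def)

lemma generators_antichain:
  assumes "\<alpha> \<in> generators I" "\<beta> \<in> generators I" "root_le \<alpha> \<beta>"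
  shows "\<alpha> = \<beta>"
  using assms by (auto simp: generators_def)

lemma generators_subset:
  assumes "ad_nilpotent_ideal n I"
  shows "generators I \<subseteq> pos_roots n"
  using assms by (auto simp: generators_def ad_nilpotent_ideal_def)

lemma dual_index_sets:
  "{j - 1 |i j. (i, j) \<in> G} = (\<lambda>p. snd p - 1) ` G"
  "{i + 1 |i j. (i, j) \<in> G} = (\<lambda>p. fst p + 1) ` (G :: (nat \<times> nat) set)"
  by force+

lemma inj_on_generators:
  assumes "ad_nilpotent_ideal n I"
  shows "inj_on (\<lambda>p. snd p - 1) (generators I)" "inj_on (\<lambda>p. fst p + 1) (generators I)"
proof -
  show "inj_on (\<lambda>p. snd p - 1) (generators I)"
  proof (rule inj_onI)
    fix p q assume pq: "p \<in> generators I" "q \<in> generators I" "snd p - 1 = snd q - 1"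
    have "snd p \<ge> 1" "snd q \<ge> 1"
      using pq generators_subset[OF assms] by (auto simp: pos_roots_def)
    with pq have "root_le p q \<or> root_le q p" by (auto simp: root_le_def)
    with pq show "p = q" using generators_antichain by metis
  qed
  show "inj_on (\<lambda>p. fst p + 1) (generators I)"
  proof (rule inj_onI)
    fix p q assume pq: "p \<in> generators I" "q \<in> generators I" "fst p + 1 = fst q + 1"
    then have "root_le p q \<or> root_le q p" by (auto simp: root_le_def)
    with pq show "p = q" using generators_antichain by metis
  qed
qed

lemma length_dual_lists:
  assumes "ad_nilpotent_ideal n I"
  shows "length (sorted_list_of_set ({1..n - 1} - {j - 1 |i j. (i, j) \<in> generators I}))
           = n - 1 - card (generators I)"
    and "length (sorted_list_of_set ({2..n} - {i + 1 |i j. (i, j) \<in> generators I}))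
           = n - 1 - card (generators I)"
proof -
  let ?G = "generators I"
  have sub: "?G \<subseteq> pos_roots n" by (rule generators_subset[OF assms])
  have fin: "finite ?G" using sub finite_pos_roots finite_subset by blast
  have "(\<lambda>p. snd p - 1) ` ?G \<subseteq> {1..n - 1}" "(\<lambda>p. fst p + 1) ` ?G \<subseteq> {2..n}"
    using sub by (fastforce simp: pos_roots_def)+
  then show
    "length (sorted_list_of_set ({1..n - 1} - {j - 1 |i j. (i, j) \<in> ?G})) = n - 1 - card ?G"
    "length (sorted_list_of_set ({2..n} - {i + 1 |i j. (i, j) \<in> ?G})) = n - 1 - card ?G"
    unfolding dual_index_sets
    by (simp_all add: card_Diff_subset fin card_image inj_on_generators[OF assms] del: One_nat_def)
qed

lemma card_nth_sorted_list:
  fixes S :: "nat set"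
  assumes "finite S" "q < length (sorted_list_of_set S)"
  shows "card {x \<in> S. x < sorted_list_of_set S ! q} = q"
proof -
  let ?xs = "sorted_list_of_set S"
  have mono: "?xs ! a < ?xs ! b \<longleftrightarrow> a < b" if "a < length ?xs" "b < length ?xs" for a b
    using that sorted_wrt_nth_less[OF strict_sorted_list_of_set, of a b S]
      sorted_wrt_nth_less[OF strict_sorted_list_of_set, of b a S]
    by (cases a b rule: linorder_cases) auto
  have "{x \<in> S. x < ?xs ! q} = (\<lambda>a. ?xs ! a) ` {..<q}"
  proof (intro set_eqI iffI)
    fix x assume x: "x \<in> {x \<in> S. x < ?xs ! q}"
    then have "x \<in> set ?xs" using assms(1) by simp
    then obtain a where "a < length ?xs" "x = ?xs ! a" by (metis in_set_conv_nth)
    with x mono assms(2) show "x \<in> (\<lambda>a. ?xs ! a) ` {..<q}" by auto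
  next
    fix x assume "x \<in> (\<lambda>a. ?xs ! a) ` {..<q}"
    then obtain a where a: "a < q" "x = ?xs ! a" by auto
    then have "x \<in> set ?xs" using assms(2) by simp
    then show "x \<in> {x \<in> S. x < ?xs ! q}" using a mono assms by simp
  qed
  moreover have "inj_on (\<lambda>a. ?xs ! a) {..<q}"
    using assms by (auto simp: inj_on_def nth_eq_iff_index_eq)
  ultimately show ?thesis by (simp add: card_image)
qed

lemma dual_lists_less:
  assumes I: "ad_nilpotent_ideal n I"
    and q: "q < n - 1 - card (generators I)"
  shows "sorted_list_of_set ({1..n - 1} - {j - 1 |i j. (i, j) \<in> generators I}) ! q
           < sorted_list_of_set ({2..n} - {i + 1 |i j. (i, j) \<in> generators I}) ! q"
    (is "sorted_list_of_set ?X ! q < sorted_list_of_set ?Y ! q")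
proof (rule ccontr)
  let ?G = "generators I"
  define X where "X = ?X"
  define Y where "Y = ?Y"
  define y where "y = sorted_list_of_set Y ! q"
  have finX: "finite X" and finY: "finite Y" unfolding X_def Y_def by (rule finite_Diff, simp)+
  assume "\<not> sorted_list_of_set ?X ! q < sorted_list_of_set ?Y ! q"
  then have yx: "y \<le> sorted_list_of_set X ! q"
    unfolding y_def X_def Y_def by (simp only: not_less)
  have lX: "q < length (sorted_list_of_set X)" and lY: "q < length (sorted_list_of_set Y)"
    unfolding X_def Y_def length_dual_lists[OF I] by (rule q)+
  have yY: "y \<in> Y" using nth_mem[OF lY] finY by (simp add: y_def)
  have "card {x \<in> X. x < y} \<le> card {x \<in> X. x < sorted_list_of_set X ! q}"
    by (rule card_mono) (use yx finX in auto)
  also have "\<dots> = q" by (rule card_nth_sorted_list[OF finX lX])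
  finally have cX: "card {x \<in> X. x < y} \<le> q" .
  have "{x \<in> Y. x \<le> y} = insert y {x \<in> Y. x < y}" using yY by auto
  then have "card {x \<in> Y. x \<le> y} = Suc (card {x \<in> Y. x < y})" using finY by simp
  also have "card {x \<in> Y. x < y} = q"
    unfolding y_def by (rule card_nth_sorted_list[OF finY lY])
  finally have cY: "card {x \<in> Y. x \<le> y} = Suc q" .
  have sub: "?G \<subseteq> pos_roots n" by (rule generators_subset[OF I])
  have fin: "finite ?G" using sub finite_pos_roots finite_subset by blast
  define GX where "GX = {p \<in> ?G. snd p \<le> y}"
  define GY where "GY = {p \<in> ?G. fst p + 1 \<le> y}"
  have GG: "GX \<subseteq> GY" "finite GX" "finite GY"
    using sub fin by (auto simp: GX_def GY_def pos_roots_def)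
  have yn: "2 \<le> y" "y \<le> n" using yY unfolding Y_def by auto
  have eX: "{x \<in> X. x < y} = {1..y - 1} - (\<lambda>p. snd p - 1) ` GX"
  proof -
    have "x \<in> (\<lambda>p. snd p - 1) ` ?G \<longleftrightarrow> x \<in> (\<lambda>p. snd p - 1) ` GX" if "x < y" for x
    proof -
      have "snd p \<le> y" if "p \<in> ?G" "x = snd p - 1" for p
        using that \<open>x < y\<close> by linarith
      then show ?thesis unfolding GX_def by blast
    qed
    moreover have "x \<in> {1..n - 1} \<and> x < y \<longleftrightarrow> x \<in> {1..y - 1} \<and> x < y" for x
      using yn by (simp only: atLeastAtMost_iff) linarith
    moreover have "x \<in> {1..y - 1} \<Longrightarrow> x < y" for x
      using yn by (simp only: atLeastAtMost_iff) linarith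
    ultimately show ?thesis unfolding X_def dual_index_sets by blast
  qed
  have eY: "{x \<in> Y. x \<le> y} = {2..y} - (\<lambda>p. fst p + 1) ` GY"
  proof -
    have "x \<in> (\<lambda>p. fst p + 1) ` ?G \<longleftrightarrow> x \<in> (\<lambda>p. fst p + 1) ` GY" if "x \<le> y" for x
      using that unfolding GY_def by blast
    moreover have "x \<in> {2..n} \<and> x \<le> y \<longleftrightarrow> x \<in> {2..y} \<and> x \<le> y" for x
      using yn by (simp only: atLeastAtMost_iff) linarith
    moreover have "x \<in> {2..y} \<Longrightarrow> x \<le> y" for x by simp
    ultimately show ?thesis unfolding Y_def dual_index_sets by blast
  qed
  have "card {x \<in> X. x < y} = y - 1 - card ((\<lambda>p. snd p - 1) ` GX)"
  proof -
    have "(\<lambda>p. snd p - 1) ` GX \<subseteq> {1..y - 1}"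
      using sub by (fastforce simp: GX_def pos_roots_def)
    then show ?thesis unfolding eX using GG by (simp add: card_Diff_subset)
  qed
  also have "card ((\<lambda>p. snd p - 1) ` GX) = card GX"
    by (rule card_image, rule inj_on_subset[OF inj_on_generators(1)[OF I]]) (auto simp: GX_def)
  finally have c1: "card {x \<in> X. x < y} = y - 1 - card GX" .
  have "card {x \<in> Y. x \<le> y} = y - 1 - card ((\<lambda>p. fst p + 1) ` GY)"
  proof -
    have "(\<lambda>p. fst p + 1) ` GY \<subseteq> {2..y}"
      using sub by (fastforce simp: GY_def pos_roots_def)
    then show ?thesis unfolding eY using GG by (simp add: card_Diff_subset)
  qed
  also have "card ((\<lambda>p. fst p + 1) ` GY) = card GY"
    by (rule card_image, rule inj_on_subset[OF inj_on_generators(2)[OF I]]) (auto simp: GY_def)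
  finally have c2: "card {x \<in> Y. x \<le> y} = y - 1 - card GY" .
  have "card GX \<le> card GY" using GG by (simp add: card_mono)
  with c1 c2 cX cY show False by simp
qed

lemma generators_dual_ideal:
  assumes I: "ad_nilpotent_ideal n I"
  shows "generators (dual_ideal n I) = dual_generators n I"
proof -
  let ?D = "dual_generators n I"
  define xs where "xs = sorted_list_of_set ({1..n - 1} - {j - 1 |i j. (i, j) \<in> generators I})"
  define ys where "ys = sorted_list_of_set ({2..n} - {i + 1 |i j. (i, j) \<in> generators I})"
  have len: "length xs = n - 1 - card (generators I)" "length ys = length xs"
    using length_dual_lists[OF I] by (simp_all add: xs_def ys_def)
  have D: "?D = {(xs ! q, ys ! q) |q. q < length xs}"
    unfolding dual_generators_def xs_def[symmetric] ys_def[symmetric] set_zip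
    using len by auto
  have sx: "sorted_wrt (<) xs" and sy: "sorted_wrt (<) ys" by (simp_all add: xs_def ys_def)
  have mx: "set xs \<subseteq> {1..n - 1}" and my: "set ys \<subseteq> {2..n}" by (auto simp: xs_def ys_def)
  have root: "?D \<subseteq> pos_roots n"
  proof
    fix p assume "p \<in> ?D"
    then obtain q where q: "q < length xs" "p = (xs ! q, ys ! q)" unfolding D by auto
    have "xs ! q < ys ! q" using dual_lists_less[OF I] q len by (simp add: xs_def ys_def)
    moreover have "1 \<le> xs ! q" using mx nth_mem[OF q(1)] by auto
    moreover have "ys ! q \<le> n" using my nth_mem[of q ys] q(1) len(2)
      by (metis atLeastAtMost_iff subsetD)
    ultimately show "p \<in> pos_roots n" using q by (simp add: pos_roots_def)
  qed
  have anti: "\<alpha> = \<beta>" if ab: "\<alpha> \<in> ?D" "\<beta> \<in> ?D" "root_le \<alpha> \<beta>" for \<alpha> \<beta>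
  proof -
    obtain a b where a: "a < length xs" "\<alpha> = (xs ! a, ys ! a)"
      and b: "b < length xs" "\<beta> = (xs ! b, ys ! b)"
      using ab unfolding D by auto
    have le: "xs ! b \<le> xs ! a" "ys ! a \<le> ys ! b" using ab(3) a b by (auto simp: root_le_def)
    have "\<not> a < b" using sorted_wrt_nth_less[OF sx, of a b] b le by auto
    moreover have "\<not> b < a" using sorted_wrt_nth_less[OF sy, of b a] a le len by auto
    ultimately show ?thesis using a b by (simp add: not_less_iff_gr_or_eq)
  qed
  have trans: "root_le \<alpha> \<gamma>" if "root_le \<alpha> \<beta>" "root_le \<beta> \<gamma>" for \<alpha> \<beta> \<gamma>
    using that by (auto simp: root_le_def)
  have asym: "\<alpha> = \<beta>" if "root_le \<alpha> \<beta>" "root_le \<beta> \<alpha>" for \<alpha> \<beta>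
    using that by (auto simp: root_le_def prod_eq_iff)
  have refl: "root_le \<alpha> \<alpha>" for \<alpha> by (simp add: root_le_def)
  have incl: "?D \<subseteq> dual_ideal n I"
    using root refl unfolding dual_ideal_def ideal_generated_by_def by blast
  show ?thesis
  proof (intro set_eqI iffI)
    fix \<beta> assume b: "\<beta> \<in> generators (dual_ideal n I)"
    then obtain \<alpha> where a: "\<alpha> \<in> ?D" "root_le \<alpha> \<beta>"
      by (auto simp: generators_def dual_ideal_def ideal_generated_by_def)
    then have "\<alpha> \<in> dual_ideal n I"
      using incl by blast
    with a b have "\<alpha> = \<beta>" by (auto simp: generators_def)
    with a show "\<beta> \<in> ?D" by simp
  next
    fix \<alpha> assume a: "\<alpha> \<in> ?D"
    have "\<beta> = \<alpha>" if b: "\<beta> \<in> dual_ideal n I" "root_le \<beta> \<alpha>" for \<beta>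
    proof -
      obtain \<gamma> where c: "\<gamma> \<in> ?D" "root_le \<gamma> \<beta>"
        using b by (auto simp: dual_ideal_def ideal_generated_by_def)
      then have "\<gamma> = \<alpha>" using anti a trans b by blast
      with c b show ?thesis using asym by blast
    qed
    moreover have "\<alpha> \<in> dual_ideal n I"
      using a incl by blast
    ultimately show "\<alpha> \<in> generators (dual_ideal n I)" by (simp add: generators_def)
  qed
qed

end

theory Submission
  imports Defs
begin

text \<open>The index sets \<open>{i\<^sub>q}\<close> and \<open>{j\<^sub>q - 1}\<close> of the generators of a self-dual ideal are
  complementary in \<open>{1..n - 1}\<close>. They have the same cardinality, so \<open>n\<close> is odd, say \<open>n = 2 m + 1\<close>.
  The ideal is determined by \<open>A = {i\<^sub>q}\<close>, and the condition \<open>i\<^sub>q < j\<^sub>q\<close> says that reading the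
  elements of \<open>A\<close> as up-steps and those of the complement as down-steps gives a Dyck path of length
  \<open>2 m\<close>. Paths of length \<open>k\<close> with \<open>a\<close> up-steps that stay above the axis are counted by
  \<open>k choose a - k choose (a + 1)\<close>, by induction on the last step.\<close>

section \<open>Counting ballot sets\<close>

definition ballot_sets :: "nat \<Rightarrow> nat \<Rightarrow> nat set set" where
  "ballot_sets k a =
     {A. A \<subseteq> {1..k} \<and> card A = a \<and> (\<forall>y\<le>k. y \<le> 2 * card (A \<inter> {1..y}))}"

lemma finite_ballot_sets: "finite (ballot_sets k a)"
  by (rule finite_subset[of _ "Pow {1..k}"]) (auto simp: ballot_sets_def)

lemma ballot_sets_eq_empty:
  assumes "2 * a < k"
  shows "ballot_sets k a = {}"
proof -
  have False if "A \<in> ballot_sets k a" for A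
  proof -
    have "A \<inter> {1..k} = A" "card A = a" "k \<le> 2 * card (A \<inter> {1..k})"
      using that by (auto simp: ballot_sets_def)
    with assms show False by simp
  qed
  then show ?thesis by blast
qed

text \<open>A last down-step adds one prefix condition, at \<open>Suc k\<close>. There all of
  \<open>A\<close> is counted, so the condition becomes the assumption
  \<open>Suc k \<le> 2 * a\<close>.\<close>

lemma ballot_sets_Suc_notin:
  assumes "Suc k \<le> 2 * a"
  shows "{A \<in> ballot_sets (Suc k) a. Suc k \<notin> A} = ballot_sets k a"
proof (intro set_eqI iffI)
  fix A assume "A \<in> {A \<in> ballot_sets (Suc k) a. Suc k \<notin> A}"
  then show "A \<in> ballot_sets k a"
    by (auto simp: ballot_sets_def atLeastAtMostSuc_conv)
next
  fix A assume A: "A \<in> ballot_sets k a"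
  then have "A \<inter> {1..Suc k} = A" "Suc k \<notin> A"
    by (auto simp: ballot_sets_def)
  with A assms show "A \<in> {A \<in> ballot_sets (Suc k) a. Suc k \<notin> A}"
    by (auto simp: ballot_sets_def le_Suc_eq)
qed

lemma ballot_sets_Suc_in:
  assumes "Suc k \<le> 2 * Suc a"
  shows "{A \<in> ballot_sets (Suc k) (Suc a). Suc k \<in> A} = insert (Suc k) ` ballot_sets k a"
proof (intro set_eqI iffI)
  fix A assume A: "A \<in> {A \<in> ballot_sets (Suc k) (Suc a). Suc k \<in> A}"
  define B where "B = A - {Suc k}"
  have AB: "A = insert (Suc k) B" and sub: "B \<subseteq> {1..k}"
    using A by (auto simp: B_def ballot_sets_def le_Suc_eq)
  have "card B = a"
    using A by (simp add: B_def ballot_sets_def)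
  moreover have "y \<le> 2 * card (B \<inter> {1..y})" if "y \<le> k" for y
  proof -
    have "A \<inter> {1..y} = B \<inter> {1..y}" using that by (auto simp: AB)
    moreover have "y \<le> 2 * card (A \<inter> {1..y})" using A that by (simp add: ballot_sets_def)
    ultimately show ?thesis by simp
  qed
  ultimately have "B \<in> ballot_sets k a"
    using A sub by (auto simp: ballot_sets_def)
  with AB show "A \<in> insert (Suc k) ` ballot_sets k a" by blast
next
  fix A assume "A \<in> insert (Suc k) ` ballot_sets k a"
  then obtain B where B: "B \<in> ballot_sets k a" "A = insert (Suc k) B" by blast
  have sub: "B \<subseteq> {1..k}" using B by (simp add: ballot_sets_def)
  then have "finite B" "Suc k \<notin> B" by (auto intro: finite_subset)
  then have card: "card A = Suc a" using B by (simp add: ballot_sets_def)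
  have sub': "A \<subseteq> {1..Suc k}" using B sub by auto
  then have "A \<inter> {1..Suc k} = A" by blast
  moreover have "A \<inter> {1..y} = B \<inter> {1..y}" if "y \<le> k" for y
    using that B by auto
  ultimately show "A \<in> {A \<in> ballot_sets (Suc k) (Suc a). Suc k \<in> A}"
    using B assms card sub' by (auto simp: ballot_sets_def le_Suc_eq)
qed

text \<open>Sorting paths by their last step gives Pascal's recursion, which a difference of
  binomial coefficients satisfies as well.\<close>

lemma card_ballot_sets_Suc:
  assumes "Suc k \<le> 2 * Suc a"
  shows "card (ballot_sets (Suc k) (Suc a)) = card (ballot_sets k (Suc a)) + card (ballot_sets k a)"
proof -
  let ?S = "ballot_sets (Suc k) (Suc a)"
  have "card ?S = card {A \<in> ?S. Suc k \<notin> A} + card {A \<in> ?S. Suc k \<in> A}"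
    by (subst card_Un_disjoint[symmetric])
      (auto intro: arg_cong[where f = card] finite_subset[OF _ finite_ballot_sets])
  also have "{A \<in> ?S. Suc k \<notin> A} = ballot_sets k (Suc a)"
    by (rule ballot_sets_Suc_notin[OF assms])
  also have "{A \<in> ?S. Suc k \<in> A} = insert (Suc k) ` ballot_sets k a"
    by (rule ballot_sets_Suc_in[OF assms])
  also have "card (insert (Suc k) ` ballot_sets k a) = card (ballot_sets k a)"
  proof (rule card_image, rule inj_onI)
    fix A B assume "A \<in> ballot_sets k a" "B \<in> ballot_sets k a"
      and eq: "insert (Suc k) A = insert (Suc k) B"
    then have "Suc k \<notin> A" "Suc k \<notin> B" by (auto simp: ballot_sets_def)
    with eq show "A = B" by (simp add: insert_ident)
  qed
  finally show ?thesis .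
qed

text \<open>The range includes the line \<open>k = 2 a + 1\<close>, where both sides vanish: this is the boundary
  value that makes the induction go through.\<close>

lemma card_ballot_sets:
  assumes "k \<le> 2 * a + 1"
  shows "int (card (ballot_sets k a)) = int (k choose a) - int (k choose Suc a)"
  using assms
proof (induction k arbitrary: a)
  case 0
  have "ballot_sets 0 a = (if a = 0 then {{}} else {})"
    by (auto simp: ballot_sets_def)
  then show ?case by simp
next
  case (Suc k)
  show ?case
  proof (cases "k = 2 * a")
    case True
    \<comment> \<open>Here \<open>Suc k = a + Suc a\<close>, so the two binomials are mirror images
      and cancel; correspondingly, no path can end below the axis.\<close>
    then have "Suc k choose a = Suc k choose Suc a"
      by (subst binomial_symmetric) auto
    with True ballot_sets_eq_empty[of a "Suc k"] show ?thesis by simp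
  next
    case False
    with Suc.prems obtain b where b: "a = Suc b"
      by (cases a) auto
    with False Suc.prems have "Suc k \<le> 2 * Suc b" "k \<le> 2 * b + 1" by auto
    then show ?thesis
      using card_ballot_sets_Suc[of k b] Suc.IH[of b] Suc.IH[of "Suc b"] b by simp
  qed
qed

lemma card_ballot_sets_catalan:
  "real (card (ballot_sets (2 * m) m)) = 1 / real (m + 1) * real ((2 * m) choose m)"
proof -
  \<comment> \<open>Both sides equal \<open>2 * m * (2 * m - 1 choose m)\<close>.\<close>
  have "Suc m * (2 * m choose Suc m) = m * (2 * m choose m)"
    using binomial_absorb_comp[of "2 * m" m] binomial_absorption[of m "2 * m"]
    by (metis diff_add_inverse mult_2)
  then have "real (Suc m) * real (2 * m choose Suc m) = real m * real (2 * m choose m)"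
    by (metis of_nat_mult)
  moreover have "real (card (ballot_sets (2 * m) m))
      = real (2 * m choose m) - real (2 * m choose Suc m)"
    using arg_cong[OF card_ballot_sets[of "2 * m" m], of real_of_int] by simp
  ultimately have "real (m + 1) * real (card (ballot_sets (2 * m) m))
      = real (m + 1) * real (2 * m choose m) - real m * real (2 * m choose m)"
    by (simp only: right_diff_distrib Suc_eq_plus1)
  also have "\<dots> = real (2 * m choose m)" by (simp add: algebra_simps)
  finally have "real (m + 1) * real (card (ballot_sets (2 * m) m)) = real (2 * m choose m)" .
  then show ?thesis by (simp add: field_simps)
qed

section \<open>Generators of self-dual ideals\<close>

text \<open>The antichain hypothesis keeps every element of \<open>G\<close> minimal: anything below
  it lies above some element of \<open>G\<close>, which must be the same one.\<close>

lemma generators_ideal_generated_by: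
  assumes root: "G \<subseteq> pos_roots n"
    and anti: "\<And>\<alpha> \<beta>. \<alpha> \<in> G \<Longrightarrow> \<beta> \<in> G \<Longrightarrow> root_le \<alpha> \<beta> \<Longrightarrow> \<alpha> = \<beta>"
  shows "generators (ideal_generated_by n G) = G"
proof -
  have trans: "root_le \<alpha> \<gamma>" if "root_le \<alpha> \<beta>" "root_le \<beta> \<gamma>" for \<alpha> \<beta> \<gamma>
    using that by (auto simp: root_le_def)
  have asym: "\<alpha> = \<beta>" if "root_le \<alpha> \<beta>" "root_le \<beta> \<alpha>" for \<alpha> \<beta>
    using that by (auto simp: root_le_def prod_eq_iff)
  have incl: "G \<subseteq> ideal_generated_by n G"
    using root unfolding ideal_generated_by_def by (auto simp: root_le_def)
  show ?thesis
  proof (intro set_eqI iffI)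
    fix \<beta> assume b: "\<beta> \<in> generators (ideal_generated_by n G)"
    then obtain \<alpha> where a: "\<alpha> \<in> G" "root_le \<alpha> \<beta>"
      by (auto simp: generators_def ideal_generated_by_def)
    with b incl have "\<alpha> = \<beta>" by (auto simp: generators_def)
    with a show "\<beta> \<in> G" by simp
  next
    fix \<alpha> assume a: "\<alpha> \<in> G"
    have "\<beta> = \<alpha>" if b: "\<beta> \<in> ideal_generated_by n G" "root_le \<beta> \<alpha>" for \<beta>
    proof -
      obtain \<gamma> where c: "\<gamma> \<in> G" "root_le \<gamma> \<beta>"
        using b by (auto simp: ideal_generated_by_def)
      then have "\<gamma> = \<alpha>" using anti a trans b by blast
      with c b show ?thesis using asym by blast
    qed
    with a incl show "\<alpha> \<in> generators (ideal_generated_by n G)"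
      by (auto simp: generators_def)
  qed
qed

lemma ad_nilpotent_ideal_ideal_generated_by:
  "ad_nilpotent_ideal n (ideal_generated_by n G)"
  unfolding ad_nilpotent_ideal_def ideal_generated_by_def root_le_def
  by (auto intro: order_trans)

lemma self_dual_generators:
  assumes "ad_nilpotent_ideal n I" "self_dual n I"
  shows "generators I = dual_generators n I"
  using generators_dual_ideal[OF assms(1)] assms(2) by (simp add: self_dual_def)

lemma fst_image_dual_generators:
  assumes "ad_nilpotent_ideal n I"
  shows "fst ` dual_generators n I = {1..n - 1} - (\<lambda>p. snd p - 1) ` generators I"
proof -
  have zip: "fst ` set (zip xs ys) = set xs" if "length xs = length ys" for xs ys :: "nat list"
    by (metis that list.set_map map_fst_zip)
  show ?thesis
    unfolding dual_generators_def zip[OF trans[OF length_dual_lists(1)[OF assms]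
        length_dual_lists(2)[OF assms, symmetric]]]
    by (simp only: dual_index_sets(1) set_sorted_list_of_set finite_Diff finite_atLeastAtMost)
qed

lemma card_dual_generators:
  assumes "ad_nilpotent_ideal n I"
  shows "card (dual_generators n I) = n - 1 - card (generators I)"
  unfolding dual_generators_def using length_dual_lists[OF assms]
  by (subst distinct_card) (simp_all add: distinct_zipI1)

text \<open>Duality turns \<open>k\<close> generators into \<open>n - 1 - k\<close>, so a fixed
  point balances the two. This is the parity obstruction for even \<open>n\<close>, and for odd
  \<open>n\<close> it fixes the number of up-steps.\<close>

lemma self_dual_card_generators:
  assumes "ad_nilpotent_ideal n I" "self_dual n I"
  shows "2 * card (generators I) = n - 1"
  using card_dual_generators[OF assms(1)] self_dual_generators[OF assms] by simp

text \<open>The pairing rule of \<open>dual_generators\<close>, with the complement of the values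
  \<open>j - 1\<close> replaced by \<open>A\<close>, which is what it equals for a self-dual ideal
  with left ends \<open>A\<close>.\<close>

definition complementary_generators :: "nat \<Rightarrow> nat set \<Rightarrow> (nat \<times> nat) set" where
  "complementary_generators n A =
     set (zip (sorted_list_of_set A) (sorted_list_of_set ({2..n} - Suc ` A)))"

lemma self_dual_complementary_generators:
  assumes "ad_nilpotent_ideal n I" "self_dual n I"
  shows "generators I = complementary_generators n (fst ` generators I)"
proof -
  let ?A = "fst ` generators I"
  have A: "?A = {1..n - 1} - (\<lambda>p. snd p - 1) ` generators I"
    using fst_image_dual_generators[OF assms(1)] self_dual_generators[OF assms] by simp
  have "generators I = dual_generators n I" by (rule self_dual_generators[OF assms])
  also have "\<dots> = complementary_generators n ?A"
    unfolding dual_generators_def complementary_generators_def dual_index_sets A[symmetric]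
    by (simp add: image_image)
  finally show ?thesis .
qed

text \<open>Each down-step \<open>j - 1\<close> in a prefix belongs to a generator whose up-step
  \<open>i\<close> satisfies \<open>i \<le> j - 1\<close>, hence lies in the same prefix. As
  distinct generators have distinct left ends, down-steps never outnumber up-steps.\<close>

lemma self_dual_fst_generators_ballot:
  assumes I: "ad_nilpotent_ideal (2 * m + 1) I" "self_dual (2 * m + 1) I"
  shows "fst ` generators I \<in> ballot_sets (2 * m) m"
proof -
  define G where "G = generators I"
  define A where "A = fst ` G"
  have A: "A = {1..2 * m} - (\<lambda>p. snd p - 1) ` G"
    using fst_image_dual_generators[OF I(1)] self_dual_generators[OF I]
    by (simp add: A_def G_def)
  then have sub: "A \<subseteq> {1..2 * m}" and fin: "finite A" by auto
  have root: "G \<subseteq> pos_roots (2 * m + 1)"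
    unfolding G_def by (rule generators_subset[OF I(1)])
  have "card G = m" using self_dual_card_generators[OF I] by (simp add: G_def)
  moreover have "inj_on fst G"
    using inj_on_generators(2)[OF I(1)] by (auto simp: inj_on_def G_def)
  ultimately have card: "card A = m" by (simp add: A_def card_image)
  have "y \<le> 2 * card (A \<inter> {1..y})" if y: "y \<le> 2 * m" for y
  proof -
    define H where "H = {p \<in> G. snd p - 1 \<le> y}"
    have finG: "finite G" using root finite_pos_roots finite_subset by blast
    then have finH: "finite H" by (simp add: H_def)
    have HA: "fst ` H \<subseteq> A \<inter> {1..y}"
    proof
      fix x assume "x \<in> fst ` H"
      then obtain p where p: "p \<in> G" "snd p - 1 \<le> y" "x = fst p"
        by (auto simp: H_def)
      then have "1 \<le> fst p" "fst p < snd p" using root by (auto simp: pos_roots_def)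
      with p show "x \<in> A \<inter> {1..y}" by (auto simp: A_def)
    qed
    \<comment> \<open>Self-duality enters here: every position missing from \<open>A\<close> is some
      \<open>j - 1\<close>.\<close>
    have "{1..y} - A \<subseteq> (\<lambda>p. snd p - 1) ` H"
      using y unfolding A H_def by auto
    then have "card ({1..y} - A) \<le> card ((\<lambda>p. snd p - 1) ` H)"
      using finH by (intro card_mono) auto
    also have "\<dots> \<le> card H" using finH by (rule card_image_le)
    also have "\<dots> = card (fst ` H)"
      using \<open>inj_on fst G\<close> by (subst card_image) (auto simp: H_def inj_on_def)
    also have "\<dots> \<le> card (A \<inter> {1..y})" using HA fin by (intro card_mono) auto
    finally have "card ({1..y} - A) \<le> card (A \<inter> {1..y})" .
    moreover have "card ({1..y} - A) + card (A \<inter> {1..y}) = y"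
      using card_Int_Diff[of "{1..y}" A] by (simp add: Int_commute)
    ultimately show ?thesis by simp
  qed
  with sub card show ?thesis by (simp add: ballot_sets_def A_def G_def)
qed

section \<open>From ballot sets to self-dual ideals\<close>

context
  fixes m :: nat and A :: "nat set"
  assumes A: "A \<in> ballot_sets (2 * m) m"
begin

text \<open>The positions outside \<open>A\<close>, shifted by one to turn \<open>j - 1\<close> into
  \<open>j\<close>: the prospective right ends.\<close>

private definition "B = {2..2 * m + 1} - Suc ` A"

private lemma finite_A: "finite A" and A_subset: "A \<subseteq> {1..2 * m}" and card_A: "card A = m"
  using A by (auto simp: ballot_sets_def intro: finite_subset)

private lemma finite_B: "finite B"
  by (simp add: B_def)

private lemma card_B: "card B = m"
proof -
  have "Suc ` A \<subseteq> {2..2 * m + 1}" using A_subset by force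
  then show ?thesis
    unfolding B_def using finite_A card_A by (simp add: card_Diff_subset card_image)
qed

text \<open>Suppose the right end \<open>y\<close> does not exceed the left end \<open>x\<close>.
  Then at most \<open>q\<close> up-steps but \<open>q + 1\<close> down-steps occur among the first
  \<open>y - 1\<close> positions, contrary to the ballot condition.\<close>

private lemma nth_less:
  assumes q: "q < m"
  shows "sorted_list_of_set A ! q < sorted_list_of_set B ! q"
proof (rule ccontr)
  define x where "x = sorted_list_of_set A ! q"
  define y where "y = sorted_list_of_set B ! q"
  assume "\<not> sorted_list_of_set A ! q < sorted_list_of_set B ! q"
  then have yx: "y \<le> x" by (simp add: x_def y_def)
  have "y \<in> B"
    using nth_mem[of q "sorted_list_of_set B"] q finite_B card_B by (simp add: y_def)
  then have y: "2 \<le> y" "y \<le> 2 * m + 1" by (auto simp: B_def)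
  have "y - 1 \<le> 2 * card (A \<inter> {1..y - 1})"
    using A y by (simp add: ballot_sets_def)
  moreover have "card (A \<inter> {1..y - 1}) \<le> card {z \<in> A. z < x}"
    using finite_A yx y by (intro card_mono) auto
  moreover have "card {z \<in> A. z < x} = q"
    unfolding x_def using q finite_A card_A by (intro card_nth_sorted_list) auto
  ultimately have le: "y - 1 \<le> card (A \<inter> {1..y - 1}) + q" by linarith
  \<comment> \<open>Shifted by one, the first \<open>y - 1\<close> positions split into up-steps and
    down-steps.\<close>
  have "{2..y} = Suc ` (A \<inter> {1..y - 1}) \<union> {z \<in> B. z \<le> y}"
  proof -
    have "z \<in> Suc ` (A \<inter> {1..y - 1})" if "z \<in> {2..y}" "z \<notin> B" for z
      using that y by (auto simp: B_def)
    then show ?thesis using y by (auto simp: B_def)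
  qed
  moreover have "Suc ` (A \<inter> {1..y - 1}) \<inter> {z \<in> B. z \<le> y} = {}"
    by (auto simp: B_def)
  ultimately have "card {2..y} = card (Suc ` (A \<inter> {1..y - 1})) + card {z \<in> B. z \<le> y}"
    using finite_A finite_B by (simp add: card_Un_disjoint)
  moreover have "card (Suc ` (A \<inter> {1..y - 1})) = card (A \<inter> {1..y - 1})"
    by (simp add: card_image)
  \<comment> \<open>Indexing from 0 puts \<open>q\<close> elements strictly below \<open>y\<close>;
    counting \<open>y\<close> itself supplies the extra down-step that gives the
    contradiction.\<close>
  moreover have "card {z \<in> B. z \<le> y} = Suc q"
  proof -
    have "{z \<in> B. z \<le> y} = insert y {z \<in> B. z < y}" using \<open>y \<in> B\<close> by auto
    moreover have "card {z \<in> B. z < y} = q"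
      unfolding y_def using q finite_B card_B by (intro card_nth_sorted_list) auto
    ultimately show ?thesis using finite_B by simp
  qed
  ultimately show False using le y by simp
qed

private lemma complementary_generators_nth:
  "complementary_generators (2 * m + 1) A =
     {(sorted_list_of_set A ! q, sorted_list_of_set B ! q) |q. q < m}"
  unfolding complementary_generators_def B_def[symmetric] set_zip
  using card_A card_B by auto

private lemma image_complementary_generators:
  "fst ` complementary_generators (2 * m + 1) A = A"
  "snd ` complementary_generators (2 * m + 1) A = B"
proof -
  have len: "length (sorted_list_of_set A) = length (sorted_list_of_set B)"
    using card_A card_B by simp
  show "fst ` complementary_generators (2 * m + 1) A = A"
    unfolding complementary_generators_def B_def[symmetric]
    using finite_A by (metis len list.set_map map_fst_zip set_sorted_list_of_set)
  show "snd ` complementary_generators (2 * m + 1) A = B"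
    unfolding complementary_generators_def B_def[symmetric]
    using finite_B by (metis len list.set_map map_snd_zip set_sorted_list_of_set)
qed

lemma generators_complementary_ideal:
  "generators (ideal_generated_by (2 * m + 1) (complementary_generators (2 * m + 1) A))
     = complementary_generators (2 * m + 1) A"
    (is "generators (ideal_generated_by ?n ?G) = ?G")
proof (rule generators_ideal_generated_by)
  show "?G \<subseteq> pos_roots ?n"
  proof
    fix p assume p: "p \<in> ?G"
    then have "fst p < snd p"
      using nth_less unfolding complementary_generators_nth by auto
    moreover have "fst p \<in> A" "snd p \<in> B"
      using p image_complementary_generators by blast+
    ultimately show "p \<in> pos_roots ?n"
      using A_subset by (auto simp: pos_roots_def B_def)
  qed
next
  fix \<alpha> \<beta> assume ab: "\<alpha> \<in> ?G" "\<beta> \<in> ?G" "root_le \<alpha> \<beta>"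
  let ?xs = "sorted_list_of_set A" and ?ys = "sorted_list_of_set B"
  obtain a b where a: "a < m" "\<alpha> = (?xs ! a, ?ys ! a)" and b: "b < m" "\<beta> = (?xs ! b, ?ys ! b)"
    using ab unfolding complementary_generators_nth by blast
  \<comment> \<open>\<open>root_le\<close> reverses the first coordinates, whereas both lists
    increase strictly; so distinct pairs are incomparable.\<close>
  have le: "?xs ! b \<le> ?xs ! a" "?ys ! a \<le> ?ys ! b" using ab(3) a b by (auto simp: root_le_def)
  have "\<not> a < b"
    using sorted_wrt_nth_less[OF strict_sorted_list_of_set, of a b A] b le card_A by auto
  moreover have "\<not> b < a"
    using sorted_wrt_nth_less[OF strict_sorted_list_of_set, of b a B] a le card_B by auto
  ultimately show "\<alpha> = \<beta>" using a b by (simp add: not_less_iff_gr_or_eq)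
qed

lemma fst_generators_complementary_ideal:
  "fst ` generators (ideal_generated_by (2 * m + 1) (complementary_generators (2 * m + 1) A)) = A"
  by (simp only: generators_complementary_ideal image_complementary_generators)

text \<open>Since the values \<open>j - 1\<close> fill the complement of \<open>A\<close>,
  complementing them returns \<open>A\<close>; the second list agrees by construction. So
  \<open>dual_generators\<close> reproduces the pairing it started from.\<close>

lemma self_dual_complementary_ideal:
  "self_dual (2 * m + 1)
     (ideal_generated_by (2 * m + 1) (complementary_generators (2 * m + 1) A))"
    (is "self_dual ?n (ideal_generated_by _ ?G)")
proof -
  have "(\<lambda>p. snd p - 1) ` ?G = (\<lambda>j. j - 1) ` snd ` ?G"
    by (simp add: image_image)
  also have "\<dots> = {1..2 * m} - A"
  proof -
    have "x \<in> (\<lambda>j. j - 1) ` B" if "x \<in> {1..2 * m} - A" for x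
      using that by (intro image_eqI[of _ _ "Suc x"]) (auto simp: B_def)
    \<comment> \<open>Elements of \<open>B\<close> are at least 2, so truncated subtraction is a
      genuine shift.\<close>
    moreover have "j - 1 \<in> {1..2 * m} - A" if "j \<in> B" for j
      using that by (cases j) (auto simp: B_def)
    ultimately show ?thesis unfolding image_complementary_generators by blast
  qed
  finally have "{1..?n - 1} - (\<lambda>p. snd p - 1) ` ?G = A"
    using A_subset by auto
  moreover have "(\<lambda>p. fst p + 1) ` ?G = Suc ` A"
    by (metis (no_types, lifting) Suc_eq_plus1 image_complementary_generators(1) image_cong image_image)
  ultimately have "dual_generators ?n (ideal_generated_by ?n ?G) = ?G"
    unfolding dual_generators_def dual_index_sets generators_complementary_ideal
    by (simp only: complementary_generators_def)
  then show ?thesis by (simp add: self_dual_def dual_ideal_def)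
qed

end

section \<open>The bijection and the final count\<close>

lemma bij_betw_ballot_sets_self_dual:
  "bij_betw (\<lambda>A. ideal_generated_by (2 * m + 1) (complementary_generators (2 * m + 1) A))
     (ballot_sets (2 * m) m) {I. ad_nilpotent_ideal (2 * m + 1) I \<and> self_dual (2 * m + 1) I}"
proof (rule bij_betw_byWitness[where f' = "\<lambda>I. fst ` generators I"])
  let ?n = "2 * m + 1"
  show "\<forall>I\<in>{I. ad_nilpotent_ideal ?n I \<and> self_dual ?n I}.
      ideal_generated_by ?n (complementary_generators ?n (fst ` generators I)) = I"
  proof (intro ballI, elim CollectE conjE)
    fix I assume I: "ad_nilpotent_ideal ?n I" "self_dual ?n I"
    \<comment> \<open>For a self-dual ideal the pairing built from its left ends is its set of dual
      generators, so it generates the dual ideal, which is \<open>I\<close>.\<close>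
    have "ideal_generated_by ?n (complementary_generators ?n (fst ` generators I)) = dual_ideal ?n I"
      using self_dual_complementary_generators[OF I] self_dual_generators[OF I]
      by (simp add: dual_ideal_def)
    with I(2) show "ideal_generated_by ?n (complementary_generators ?n (fst ` generators I)) = I"
      by (simp add: self_dual_def)
  qed
qed (use fst_generators_complementary_ideal self_dual_fst_generators_ballot
      self_dual_complementary_ideal ad_nilpotent_ideal_ideal_generated_by in \<open>auto simp del: One_nat_def\<close>)

theorem theorem4p6:
  fixes m :: nat
  assumes "m \<ge> 1"
  shows "\<not> (\<exists>I. ad_nilpotent_ideal (2 * m) I \<and> self_dual (2 * m) I) \<and>
         real (card {I. ad_nilpotent_ideal (2 * m + 1) I \<and> self_dual (2 * m + 1) I})
           = 1 / real (m + 1) * real ((2 * m) choose m)"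
proof
  show "\<not> (\<exists>I. ad_nilpotent_ideal (2 * m) I \<and> self_dual (2 * m) I)"
  proof
    assume "\<exists>I. ad_nilpotent_ideal (2 * m) I \<and> self_dual (2 * m) I"
    then obtain I where "2 * card (generators I) = 2 * m - 1"
      using self_dual_card_generators by blast
    \<comment> \<open>As \<open>m \<ge> 1\<close>, the right side is a genuine odd number, while the
      left side is even.\<close>
    with assms show False by presburger
  qed
  show "real (card {I. ad_nilpotent_ideal (2 * m + 1) I \<and> self_dual (2 * m + 1) I})
      = 1 / real (m + 1) * real ((2 * m) choose m)"
    using bij_betw_same_card[OF bij_betw_ballot_sets_self_dual, of m] card_ballot_sets_catalan[of m]
    by simp
qed

end
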